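(* Let $p\ge 1$ and $n_1,\dots,n_p\ge 1$ be integers, $n=n_1+\cdots+n_p$, and let $A=(A_{[ab]})_{1\le a,b\le p}$ be an $n\times n$ complex matrix written in block form, with $A_{[ab]}\in M_{n_a,n_b}(\mathbb{C})$. Let $A^{\diamond}$ be the $n\times n$ matrix with entries in the ring $R=\bigoplus_{k,l\ge1}M_{k,l}(\mathbb{C})$ defined by $A^{\diamond}_{ij}=A_{[\mathsf{b}(i)\mathsf{b}(j)]}$ for all $i,j\in\{1,\dots,n\}$. Then $$n_1!\cdots n_p!\,\det A={\det}_{\operatorname{Tr}}(A^{\diamond}).$$
   Context: The set $\{1,\dots,n\}$ is split into consecutive intervals $I_1,\dots,I_p$ of sizes $n_1,\dots,n_p$, and $\mathsf{b}(i)\in\{1,\dots,p\}$ is the unique index with $i\in I_{\mathsf{b}(i)}$. In the ring $R=\bigoplus_{k,l\ge 1}M_{k,l}(\mathbb{C})$ the product of a matrix of size $(k,l)$ and a matrix of size $(k',l')$ is the usual matrix product if $l=k'$ and is $0$ if $l\ne k'$ (extended bilinearly). Let $\tau:R\to\mathbb{C}$ be the linear map equal to the usual trace on $M_{k,l}(\mathbb{C})$ when $k=l$ and to $0$ when $k\neq l$; it satisfies $\tau(uv)=\tau(vu)$. The trace-determinant of $M\in M_n(R)$ is $${\det}_{\operatorname{Tr}}(M)=\sum_{\sigma\in\mathfrak{S}_n}\varepsilon(\sigma)\prod_{(i_1\cdots i_r)\preccurlyeq\sigma}\tau(M_{i_1i_2}M_{i_2i_3}\cdots M_{i_ri_1}),$$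 where $\mathfrak{S}_n$ is the group of permutations of $\{1,\dots,n\}$, $\varepsilon$ is the signature, and the product is over all cycles of $\sigma$ (fixed points being cycles of length $1$). *)

theory Defs
  imports
    "Jordan_Normal_Form.Determinant"
    "HOL-Combinatorics.Orbits"
    "HOL-Combinatorics.Cycles"
begin

section \<open>The ring of complex matrices of all sizes\<close>

text \<open>An element of the direct sum of the spaces of \<open>k \<times> l\<close> matrices over \<open>k, l \<ge> 1\<close> is the family of
  its components. Indices \<open>k = 0\<close> or \<open>l = 0\<close> contribute nothing: \<open>carrier_mat k l\<close> is then the
  one-element set \<open>{0\<^sub>m k l}\<close>.\<close>

typedef matring =
  "{f :: nat \<Rightarrow> nat \<Rightarrow> complex mat.
      (\<forall>k l. f k l \<in> carrier_mat k l) \<and> finite {(k, l). f k l \<noteq> 0\<^sub>m k l}}"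
  morphisms component Abs_matring
  by (rule exI[of _ "\<lambda>k l. 0\<^sub>m k l"]) auto

setup_lifting type_definition_matring

lemma component_carrier [simp]: "component u k l \<in> carrier_mat k l"
  using component[of u] by auto

lemma dim_component [simp]: "dim_row (component u k l) = k" "dim_col (component u k l) = l"
  using component_carrier[of u k l] by (auto simp del: component_carrier)

lemma finite_component: "finite {(k, l). component u k l \<noteq> 0\<^sub>m k l}"
  using component[of u] by auto

lemma matring_eqI:
  assumes "\<And>k l i j. i < k \<Longrightarrow> j < l \<Longrightarrow> component u k l $$ (i, j) = component v k l $$ (i, j)"
  shows "u = v"
proof -
  have "component u k l = component v k l" for k l
    by (rule eq_matI) (auto simp: assms)
  then show ?thesis
    by (metis component_inject ext)
qed

lemma finite_row: "finite {m. component u k m \<noteq> 0\<^sub>m k m}"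
  by (rule finite_subset[OF _ finite_imageI[OF finite_component[of u], of snd]]) (auto simp: image_iff)

lemma finite_diag: "finite {k. component u k k \<noteq> 0\<^sub>m k k}"
  by (rule finite_subset[OF _ finite_imageI[OF finite_component[of u], of snd]]) (auto simp: image_iff)

instantiation matring :: ring
begin

lift_definition zero_matring :: matring is "\<lambda>k l. 0\<^sub>m k l" by auto

lift_definition plus_matring :: "matring \<Rightarrow> matring \<Rightarrow> matring"
  is "\<lambda>f g k l. f k l + g k l"
proof -
  fix f g :: "nat \<Rightarrow> nat \<Rightarrow> complex mat"
  assume f: "(\<forall>k l. f k l \<in> carrier_mat k l) \<and> finite {(k, l). f k l \<noteq> 0\<^sub>m k l}"
    and g: "(\<forall>k l. g k l \<in> carrier_mat k l) \<and> finite {(k, l). g k l \<noteq> 0\<^sub>m k l}"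
  have "{(k, l). f k l + g k l \<noteq> 0\<^sub>m k l}
      \<subseteq> {(k, l). f k l \<noteq> 0\<^sub>m k l} \<union> {(k, l). g k l \<noteq> 0\<^sub>m k l}" by auto
  with f g show "(\<forall>k l. f k l + g k l \<in> carrier_mat k l) \<and> finite {(k, l). f k l + g k l \<noteq> 0\<^sub>m k l}"
    by (auto intro: finite_subset)
qed

lift_definition uminus_matring :: "matring \<Rightarrow> matring" is "\<lambda>f k l. - f k l"
proof -
  fix f :: "nat \<Rightarrow> nat \<Rightarrow> complex mat"
  assume f: "(\<forall>k l. f k l \<in> carrier_mat k l) \<and> finite {(k, l). f k l \<noteq> 0\<^sub>m k l}"
  have "{(k, l). - f k l \<noteq> 0\<^sub>m k l} \<subseteq> {(k, l). f k l \<noteq> 0\<^sub>m k l}"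
    by (auto intro!: eq_matI)
  with f show "(\<forall>k l. - f k l \<in> carrier_mat k l) \<and> finite {(k, l). - f k l \<noteq> 0\<^sub>m k l}"
    by (auto intro: finite_subset)
qed

definition minus_matring :: "matring \<Rightarrow> matring \<Rightarrow> matring" where
  "minus_matring u v = u + (- v)"

text \<open>The \<open>(k, l)\<close> component of a product is the sum over \<open>m\<close> of the products of the \<open>(k, m)\<close> and
  \<open>(m, l)\<close> components.  The sum is written entrywise, because matrices of a fixed size do not form
  a type.\<close>

lift_definition times_matring :: "matring \<Rightarrow> matring \<Rightarrow> matring"
  is "\<lambda>f g k l. mat k l (\<lambda>(i, j). \<Sum>m | f k m \<noteq> 0\<^sub>m k m. (f k m * g m l) $$ (i, j))"
proof -
  fix f g :: "nat \<Rightarrow> nat \<Rightarrow> complex mat"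
  assume f: "(\<forall>k l. f k l \<in> carrier_mat k l) \<and> finite {(k, l). f k l \<noteq> 0\<^sub>m k l}"
    and g: "(\<forall>k l. g k l \<in> carrier_mat k l) \<and> finite {(k, l). g k l \<noteq> 0\<^sub>m k l}"
  let ?h = "\<lambda>k l. mat k l (\<lambda>(i, j). \<Sum>m | f k m \<noteq> 0\<^sub>m k m. (f k m * g m l) $$ (i, j))"
  let ?F = "{(k, l). f k l \<noteq> 0\<^sub>m k l}" and ?G = "{(k, l). g k l \<noteq> 0\<^sub>m k l}"
  have "{(k, l). ?h k l \<noteq> 0\<^sub>m k l} \<subseteq> fst ` ?F \<times> snd ` ?G"
  proof clarify
    fix k l assume ne: "?h k l \<noteq> 0\<^sub>m k l"
    have "\<exists>m. f k m \<noteq> 0\<^sub>m k m \<and> g m l \<noteq> 0\<^sub>m m l"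
    proof (rule ccontr)
      assume c: "\<not> ?thesis"
      have "?h k l = 0\<^sub>m k l"
      proof (rule eq_matI)
        fix i j assume ij: "i < dim_row (0\<^sub>m k l :: complex mat)" "j < dim_col (0\<^sub>m k l :: complex mat)"
        have "(f k m * g m l) $$ (i, j) = 0" if "f k m \<noteq> 0\<^sub>m k m" for m
        proof -
          have "g m l = 0\<^sub>m m l" using c that by auto
          moreover have "f k m \<in> carrier_mat k m" using f by auto
          ultimately have "f k m * g m l = 0\<^sub>m k l" by simp
          then show ?thesis using ij by simp
        qed
        then show "?h k l $$ (i, j) = 0\<^sub>m k l $$ (i, j)" using ij by (auto intro!: sum.neutral)
      qed auto
      with ne show False by simp
    qed
    then obtain m where m: "f k m \<noteq> 0\<^sub>m k m" "g m l \<noteq> 0\<^sub>m m l" by blast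
    have "k \<in> fst ` ?F" using m by (intro image_eqI[of _ _ "(k, m)"]) auto
    moreover have "l \<in> snd ` ?G" using m by (intro image_eqI[of _ _ "(m, l)"]) auto
    ultimately show "k \<in> fst ` ?F \<and> l \<in> snd ` ?G" by simp
  qed
  moreover have "finite (fst ` ?F \<times> snd ` ?G)" using f g by auto
  ultimately have "finite {(k, l). ?h k l \<noteq> 0\<^sub>m k l}" by (rule finite_subset)
  then show "(\<forall>k l. ?h k l \<in> carrier_mat k l) \<and> finite {(k, l). ?h k l \<noteq> 0\<^sub>m k l}" by auto
qed

lemma component_bound:
  obtains N where "\<And>k l. l \<ge> N \<Longrightarrow> component u k l = 0\<^sub>m k l"
proof -
  obtain N where N: "\<forall>n \<in> snd ` {(k, l). component u k l \<noteq> 0\<^sub>m k l}. n < N"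
    using finite_nat_set_iff_bounded[THEN iffD1, OF finite_imageI[OF finite_component[of u], of snd]]
    by blast
  have "component u k l = 0\<^sub>m k l" if "l \<ge> N" for k l
  proof (rule ccontr)
    assume "component u k l \<noteq> 0\<^sub>m k l"
    then have "l \<in> snd ` {(k, l). component u k l \<noteq> 0\<^sub>m k l}"
      by (intro image_eqI[of _ _ "(k, l)"]) auto
    with N that show False by (meson leD)
  qed
  with that show ?thesis by blast
qed

lemma component_times:
  assumes "\<And>m. m \<ge> N \<Longrightarrow> component u k m = 0\<^sub>m k m" and ij: "i < k" "j < l"
  shows "component (u * v) k l $$ (i, j) =
    (\<Sum>m<N. \<Sum>a<m. component u k m $$ (i, a) * component v m l $$ (a, j))"
proof -
  have "component (u * v) k l $$ (i, j) =
      (\<Sum>m | component u k m \<noteq> 0\<^sub>m k m. (component u k m * component v m l) $$ (i, j))"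
    using ij by (simp add: times_matring.rep_eq)
  also have "\<dots> = (\<Sum>m<N. (component u k m * component v m l) $$ (i, j))"
  proof (rule sum.mono_neutral_left)
    show "{m. component u k m \<noteq> 0\<^sub>m k m} \<subseteq> {..<N}"
      using assms(1) by (force simp: not_le[symmetric])
    show "\<forall>m\<in>{..<N} - {m. component u k m \<noteq> 0\<^sub>m k m}. (component u k m * component v m l) $$ (i, j) = 0"
      using ij by (auto simp: left_mult_zero_mat[OF component_carrier])
  qed auto
  also have "\<dots> = (\<Sum>m<N. \<Sum>a<m. component u k m $$ (i, a) * component v m l $$ (a, j))"
    using ij by (intro sum.cong) (auto simp: scalar_prod_def atLeast0LessThan)
  finally show ?thesis .
qed

lemma nested_sum:
  "(\<Sum>m<N. \<Sum>a<m. f m a) = (\<Sum>x \<in> Sigma {..<N} (\<lambda>m. {..<m}). f (fst x) (snd x))"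
  for N :: nat and f :: "nat \<Rightarrow> nat \<Rightarrow> 'b :: comm_monoid_add"
  by (simp add: sum.Sigma case_prod_beta)

lemma nested_sum_swap:
  "(\<Sum>m'<N. \<Sum>b<m'. \<Sum>m<N. \<Sum>a<m. f m' b m a) = (\<Sum>m<N. \<Sum>a<m. \<Sum>m'<N. \<Sum>b<m'. f m' b m a)"
  for N :: nat and f :: "nat \<Rightarrow> nat \<Rightarrow> nat \<Rightarrow> nat \<Rightarrow> 'b :: comm_monoid_add"
  unfolding nested_sum by (rule sum.swap)

instance
proof
  fix u v w :: matring
  show "u + v + w = u + (v + w)"
    by (rule matring_eqI) (simp add: plus_matring.rep_eq)
  show "u + v = v + u"
    by (rule matring_eqI) (simp add: plus_matring.rep_eq)
  show "0 + u = u"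
    by (rule matring_eqI) (simp add: plus_matring.rep_eq zero_matring.rep_eq)
  show "- u + u = 0"
    by (rule matring_eqI) (simp add: plus_matring.rep_eq zero_matring.rep_eq uminus_matring.rep_eq)
  show "u - v = u + - v"
    by (simp add: minus_matring_def)
  obtain N1 where N1: "\<And>k l. l \<ge> N1 \<Longrightarrow> component u k l = 0\<^sub>m k l" using component_bound[of u] by blast
  obtain N2 where N2: "\<And>k l. l \<ge> N2 \<Longrightarrow> component v k l = 0\<^sub>m k l" using component_bound[of v] by blast
  define N where "N = max N1 N2"
  have u: "\<And>k l. l \<ge> N \<Longrightarrow> component u k l = 0\<^sub>m k l"
    and v: "\<And>k l. l \<ge> N \<Longrightarrow> component v k l = 0\<^sub>m k l"
    using N1 N2 by (auto simp: N_def)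
  have uv: "component (u + v) k l = 0\<^sub>m k l" if "l \<ge> N" for k l
    using u[OF that] v[OF that] by (simp add: plus_matring.rep_eq)
  show "(u + v) * w = u * w + v * w"
    by (rule matring_eqI)
      (simp add: component_times[OF u] component_times[OF v] component_times[OF uv]
        plus_matring.rep_eq distrib_right sum.distrib)
  show "u * (v + w) = u * v + u * w"
    by (rule matring_eqI)
      (simp add: component_times[OF u] plus_matring.rep_eq distrib_left sum.distrib)
  have u_v: "component (u * v) k l = 0\<^sub>m k l" if "l \<ge> N" for k l
    by (rule eq_matI) (auto simp: component_times[OF u] v[OF that])
  show "(u * v) * w = u * (v * w)"
  proof (rule matring_eqI)
    fix k l i j :: nat assume ij: "i < k" "j < l"
    let ?u = "\<lambda>m a. component u k m $$ (i, a)"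
    let ?v = "\<lambda>m a m' b. component v m m' $$ (a, b)"
    let ?w = "\<lambda>m b. component w m l $$ (b, j)"
    have "component ((u * v) * w) k l $$ (i, j) =
        (\<Sum>m'<N. \<Sum>b<m'. (\<Sum>m<N. \<Sum>a<m. ?u m a * ?v m a m' b) * ?w m' b)"
      using ij by (simp add: component_times[OF u_v] component_times[OF u])
    also have "\<dots> = (\<Sum>m'<N. \<Sum>b<m'. \<Sum>m<N. \<Sum>a<m. ?u m a * (?v m a m' b * ?w m' b))"
      by (simp add: sum_distrib_right mult.assoc)
    also have "\<dots> = (\<Sum>m<N. \<Sum>a<m. \<Sum>m'<N. \<Sum>b<m'. ?u m a * (?v m a m' b * ?w m' b))"
      by (rule nested_sum_swap)
    also have "\<dots> = (\<Sum>m<N. \<Sum>a<m. ?u m a * (\<Sum>m'<N. \<Sum>b<m'. ?v m a m' b * ?w m' b))"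
      by (simp add: sum_distrib_left)
    also have "\<dots> = component (u * (v * w)) k l $$ (i, j)"
      using ij by (simp add: component_times[OF u] component_times[OF v])
    finally show "component ((u * v) * w) k l $$ (i, j) = component (u * (v * w)) k l $$ (i, j)" .
  qed
qed

end

text \<open>The inclusion of the matrices of a given size (namely that of \<open>B\<close>) into the direct sum.\<close>

lift_definition homogeneous :: "complex mat \<Rightarrow> matring"
  is "\<lambda>B k l. if k = dim_row B \<and> l = dim_col B then B else 0\<^sub>m k l"
  by (auto intro: finite_subset[of _ "{(dim_row B, dim_col B)}" for B])

lemma homogeneous_times:
  "homogeneous B * homogeneous C = (if dim_col B = dim_row C then homogeneous (B * C) else 0)"
proof (rule matring_eqI)
  fix k l i j :: nat assume ij: "i < k" "j < l"
  let ?M = "{m. component (homogeneous B) k m \<noteq> 0\<^sub>m k m}"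
  let ?g = "\<lambda>m. (component (homogeneous B) k m * component (homogeneous C) m l) $$ (i, j)"
  have z: "?g m = 0" if "m \<noteq> dim_col B" for m
    using that ij left_mult_zero_mat[OF component_carrier[of "homogeneous C" m l], of k]
    by (simp add: homogeneous.rep_eq[of B])
  have "component (homogeneous B * homogeneous C) k l $$ (i, j) = sum ?g ?M"
    using ij by (simp add: times_matring.rep_eq)
  also have "\<dots> = sum ?g {dim_col B}"
  proof (rule sum.mono_neutral_cong)
    show "?g x = 0" if "x \<in> {dim_col B} - ?M" for x
    proof -
      have "component (homogeneous B) k x = 0\<^sub>m k x" using that by blast
      then show ?thesis
        using ij by (simp only: left_mult_zero_mat[OF component_carrier]) simp
    qed
    show "?g x = 0" if "x \<in> ?M - {dim_col B}" for x
      using z[of x] that by blast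
  qed (use finite_row[of "homogeneous B" k] in auto)
  also have "\<dots> = component (if dim_col B = dim_row C then homogeneous (B * C) else 0) k l $$ (i, j)"
    using ij by (auto simp: homogeneous.rep_eq zero_matring.rep_eq scalar_prod_def)
  finally show "component (homogeneous B * homogeneous C) k l $$ (i, j) = \<dots>" .
qed

definition mat_trace :: "complex mat \<Rightarrow> complex" where
  "mat_trace B = (\<Sum>i<dim_row B. B $$ (i, i))"

definition tau :: "matring \<Rightarrow> complex" where
  "tau u = (\<Sum>k | component u k k \<noteq> 0\<^sub>m k k. mat_trace (component u k k))"

lemma tau_bound:
  assumes "\<And>k. k \<ge> N \<Longrightarrow> component u k k = 0\<^sub>m k k"
  shows "tau u = (\<Sum>k<N. \<Sum>i<k. component u k k $$ (i, i))"
  unfolding tau_def mat_trace_def dim_component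
proof (rule sum.mono_neutral_left)
  show "{k. component u k k \<noteq> 0\<^sub>m k k} \<subseteq> {..<N}"
    using assms by (force simp: not_le[symmetric])
qed auto

lemma tau_add: "tau (u + v) = tau u + tau v"
proof -
  obtain N1 where N1: "\<And>k l. l \<ge> N1 \<Longrightarrow> component u k l = 0\<^sub>m k l" using component_bound[of u] by blast
  obtain N2 where N2: "\<And>k l. l \<ge> N2 \<Longrightarrow> component v k l = 0\<^sub>m k l" using component_bound[of v] by blast
  define N where "N = max N1 N2"
  have "tau (u + v) = (\<Sum>k<N. \<Sum>i<k. component (u + v) k k $$ (i, i))"
    by (rule tau_bound) (simp add: plus_matring.rep_eq N1 N2 N_def)
  also have "\<dots> = tau u + tau v"
    by (subst (1 2) tau_bound[of N])
      (auto simp: N1 N2 N_def plus_matring.rep_eq sum.distrib)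
  finally show ?thesis .
qed

lemma tau_homogeneous:
  "tau (homogeneous B) = (if dim_row B = dim_col B then mat_trace B else 0)"
proof -
  have "tau (homogeneous B) =
      (\<Sum>k<Suc (dim_row B). \<Sum>i<k. component (homogeneous B) k k $$ (i, i))"
    by (rule tau_bound) (auto simp: homogeneous.rep_eq)
  also have "\<dots> = (\<Sum>k\<in>{dim_row B}. \<Sum>i<k. component (homogeneous B) k k $$ (i, i))"
    by (rule sum.mono_neutral_right) (auto simp: homogeneous.rep_eq)
  also have "\<dots> = (if dim_row B = dim_col B then mat_trace B else 0)"
    by (auto simp: homogeneous.rep_eq mat_trace_def)
  finally show ?thesis .
qed

lemma tau_commute: "tau (u * v) = tau (v * u)"
proof -
  obtain N1 where N1: "\<And>k l. l \<ge> N1 \<Longrightarrow> component u k l = 0\<^sub>m k l" using component_bound[of u] by blast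
  obtain N2 where N2: "\<And>k l. l \<ge> N2 \<Longrightarrow> component v k l = 0\<^sub>m k l" using component_bound[of v] by blast
  define N where "N = max N1 N2"
  have u: "\<And>k l. l \<ge> N \<Longrightarrow> component u k l = 0\<^sub>m k l"
    and v: "\<And>k l. l \<ge> N \<Longrightarrow> component v k l = 0\<^sub>m k l"
    using N1 N2 by (auto simp: N_def)
  have *: "tau (x * y) = (\<Sum>k<N. \<Sum>i<k. \<Sum>m<N. \<Sum>a<m.
      component x k m $$ (i, a) * component y m k $$ (a, i))"
    if x: "\<And>k l. l \<ge> N \<Longrightarrow> component x k l = 0\<^sub>m k l"
      and y: "\<And>k l. l \<ge> N \<Longrightarrow> component y k l = 0\<^sub>m k l" for x y
  proof -
    have "component (x * y) k k = 0\<^sub>m k k" if "k \<ge> N" for k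
      by (rule eq_matI) (auto simp: component_times[OF x] y[OF that])
    then have "tau (x * y) = (\<Sum>k<N. \<Sum>i<k. component (x * y) k k $$ (i, i))"
      by (rule tau_bound)
    also have "\<dots> = (\<Sum>k<N. \<Sum>i<k. \<Sum>m<N. \<Sum>a<m.
        component x k m $$ (i, a) * component y m k $$ (a, i))"
      by (intro sum.cong) (auto simp: component_times[OF x])
    finally show ?thesis .
  qed
  have "tau (u * v) = (\<Sum>k<N. \<Sum>i<k. \<Sum>m<N. \<Sum>a<m.
      component u k m $$ (i, a) * component v m k $$ (a, i))"
    by (rule *) (simp_all add: u v)
  also have "\<dots> = (\<Sum>m<N. \<Sum>a<m. \<Sum>k<N. \<Sum>i<k.
      component v m k $$ (a, i) * component u k m $$ (i, a))"
    by (subst nested_sum_swap) (simp only: mult.commute)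
  also have "\<dots> = tau (v * u)"
    by (rule *[symmetric]) (simp_all add: u v)
  finally show ?thesis .
qed

section \<open>The trace-determinant\<close>

text \<open>The ring \<^typ>\<open>matring\<close> has no unit, so only products of nonempty lists make sense.\<close>

fun list_product :: "'a :: semigroup_mult list \<Rightarrow> 'a" where
  "list_product [x] = x"
| "list_product (x # y # ys) = x * list_product (y # ys)"

text \<open>For \<open>is = [i\<^sub>1, \<dots>, i\<^sub>r]\<close> this is the factor attached to the cycle \<open>(i\<^sub>1 \<cdots> i\<^sub>r)\<close>: pairing \<open>is\<close> with
  its rotation yields \<open>(i\<^sub>1, i\<^sub>2), \<dots>, (i\<^sub>r, i\<^sub>1)\<close>.\<close>

definition cycle_trace :: "matring mat \<Rightarrow> nat list \<Rightarrow> complex" where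
  "cycle_trace M is = tau (list_product (map2 (\<lambda>i j. M $$ (i, j)) is (rotate1 is)))"

text \<open>The cycles of \<open>\<sigma>\<close>, fixed points included, correspond to its orbits on the index set.  The list
  \<open>support \<sigma> i\<close> is the cycle \<open>[i, \<sigma> i, \<sigma> (\<sigma> i), \<dots>]\<close> starting at \<open>i\<close>; starting at the minimum is an
  arbitrary choice that does not matter by \<open>cycle_trace_start\<close> below.\<close>

definition det_Tr :: "matring mat \<Rightarrow> complex" where
  "det_Tr M = (\<Sum>\<sigma> | \<sigma> permutes {0..<dim_row M}.
     of_int (sign \<sigma>) *
     (\<Prod>C \<in> orbit \<sigma> ` {0..<dim_row M}. cycle_trace M (support \<sigma> (Min C))))"

lemma list_product_Cons: "xs \<noteq> [] \<Longrightarrow> list_product (x # xs) = x * list_product xs"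
  by (cases xs) auto

lemma list_product_snoc: "xs \<noteq> [] \<Longrightarrow> list_product (xs @ [x]) = list_product xs * x"
  by (induction xs rule: list_product.induct) (auto simp: mult.assoc)

lemma tau_rotate1: "tau (list_product (rotate1 xs)) = tau (list_product xs)"
proof (cases xs)
  case (Cons x ys)
  then show ?thesis
    by (cases "ys = []") (auto simp: list_product_Cons list_product_snoc tau_commute)
qed simp

lemma cycle_trace_rotate1: "cycle_trace M (rotate1 is) = cycle_trace M is"
proof -
  have zip_rot: "zip (rotate1 xs) (rotate1 ys) = rotate1 (zip xs ys)"
    if "length xs = length ys" for xs ys :: "nat list"
    using that by (cases xs; cases ys) auto
  have "zip (rotate1 is) (rotate1 (rotate1 is)) = rotate1 (zip is (rotate1 is))"
    by (rule zip_rot) simp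
  then show ?thesis
    by (simp add: cycle_trace_def rotate1_map[symmetric] tau_rotate1)
qed

lemma support_apply:
  assumes "permutation \<sigma>"
  shows "support \<sigma> (\<sigma> i) = rotate1 (support \<sigma> i)"
proof -
  have inj: "inj \<sigma>" using assms permutation_bijective bij_is_inj by blast
  have "(\<sigma> ^^ n) (\<sigma> i) = \<sigma> i \<longleftrightarrow> (\<sigma> ^^ n) i = i" for n
    using inj by (metis funpow_swap1 injD)
  then have eq: "least_power \<sigma> (\<sigma> i) = least_power \<sigma> i"
    by (simp add: least_power_def)
  obtain r where r: "least_power \<sigma> i = Suc r"
    using least_power_of_permutation(2)[OF assms, of i] gr0_implies_Suc by blast
  have last: "(\<sigma> ^^ Suc r) i = i"
    using least_power_of_permutation(1)[OF assms, of i] r by simp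
  have "support \<sigma> i = i # map (\<lambda>k. (\<sigma> ^^ Suc k) i) [0..<r]"
    unfolding r by (simp add: upt_conv_Cons map_Suc_upt[symmetric] comp_def del: upt_Suc)
  moreover have "support \<sigma> (\<sigma> i) = map (\<lambda>k. (\<sigma> ^^ Suc k) i) [0..<r] @ [i]"
    unfolding eq r using last by (simp add: funpow_swap1)
  ultimately show ?thesis by simp
qed

lemma cycle_trace_start:
  assumes "permutation \<sigma>" and "j \<in> orbit \<sigma> i"
  shows "cycle_trace M (support \<sigma> j) = cycle_trace M (support \<sigma> i)"
  using assms(2)
  by (induction rule: orbit.induct) (simp_all only: support_apply[OF assms(1)] cycle_trace_rotate1)

section \<open>Block matrices\<close>

text \<open>Everything is indexed from 0: the sizes are \<open>d 0, \<dots>, d (p - 1)\<close> and the row indices are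
  \<open>0, \<dots>, n - 1\<close>.\<close>

definition offset :: "(nat \<Rightarrow> nat) \<Rightarrow> nat \<Rightarrow> nat" where
  "offset d a = (\<Sum>b<a. d b)"

definition block_interval :: "(nat \<Rightarrow> nat) \<Rightarrow> nat \<Rightarrow> nat set" where
  "block_interval d a = {offset d a..<offset d a + d a}"

definition block_index :: "nat \<Rightarrow> (nat \<Rightarrow> nat) \<Rightarrow> nat \<Rightarrow> nat" where
  "block_index p d i = (THE a. a < p \<and> i \<in> block_interval d a)"

lemma block_index_unique:
  assumes "i < (\<Sum>a<p. d a)"
  shows "\<exists>!a. a < p \<and> i \<in> block_interval d a"
proof (rule ex_ex1I)
  show "\<exists>a. a < p \<and> i \<in> block_interval d a"
    using assms
  proof (induction p)
    case (Suc p)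
    show ?case
    proof (cases "i < (\<Sum>a<p. d a)")
      case True
      with Suc.IH show ?thesis using less_SucI by blast
    next
      case False
      with Suc.prems show ?thesis
        by (intro exI[of _ p]) (auto simp: block_interval_def offset_def)
    qed
  qed simp
next
  have disj: False if "a < b" "i \<in> block_interval d a" "i \<in> block_interval d b" for a b
  proof -
    have "offset d (Suc a) \<le> offset d b"
      unfolding offset_def using that(1) by (intro sum_mono2) auto
    with that(2,3) show False by (auto simp: block_interval_def offset_def)
  qed
  show "a = b" if "a < p \<and> i \<in> block_interval d a" "b < p \<and> i \<in> block_interval d b" for a b
    using disj[of a b] disj[of b a] that by (meson linorder_neqE_nat)
qed

definition block :: "(nat \<Rightarrow> nat) \<Rightarrow> complex mat \<Rightarrow> nat \<Rightarrow> nat \<Rightarrow> complex mat" where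
  "block d A a b = mat (d a) (d b) (\<lambda>(i, j). A $$ (offset d a + i, offset d b + j))"

definition diamond :: "nat \<Rightarrow> (nat \<Rightarrow> nat) \<Rightarrow> complex mat \<Rightarrow> matring mat" where
  "diamond p d A = mat (\<Sum>a<p. d a) (\<Sum>a<p. d a)
     (\<lambda>(i, j). homogeneous (block d A (block_index p d i) (block_index p d j)))"

end

theory Submission
  imports Defs
begin

text \<open>
  The trace of a product of blocks along a cycle \<open>(i\<^sub>1 \<cdots> i\<^sub>r)\<close> is, once written out in entries, the
  sum over all choices of a row \<open>g(i)\<close> in the block of \<open>i\<close>, one for each \<open>i\<close> on the cycle, of
  \<open>A\<^bsub>g(i\<^sub>1) g(i\<^sub>2)\<^esub> \<cdots> A\<^bsub>g(i\<^sub>r) g(i\<^sub>1)\<^esub>\<close> (\<open>tau_list_product_cycle\<close>). The indices on a cycle are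
  distinct, so these choices are independent.
  The cycles of \<open>\<sigma>\<close> partition the index set, and by distributivity the product of these sums over
  all cycles is a single sum over functions \<open>g\<close> on the whole index set with \<open>g(i)\<close> in the block of
  \<open>i\<close> (\<open>prod_sum_PiE_disjoint_UN\<close>).  The range of this sum no longer depends on \<open>\<sigma>\<close>. After
  exchanging the two sums, the sum over \<open>\<sigma>\<close> is the Leibniz formula, and the trace-determinant
  becomes the sum over \<open>g\<close> of the determinants of the matrices \<open>(A\<^bsub>g(i) g(j)\<^esub>)\<^sub>i\<^sub>j\<close>
  (\<open>det_Tr_homogeneous\<close>, \<open>det_Tr_diamond\<close>).

  If \<open>g\<close> is not injective, such a matrix has two equal rows and contributes \<open>0\<close>. If \<open>g\<close> is
  injective, it is a permutation applied to the rows and to the columns, the two signs cancel, and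
  the contribution is \<open>det A\<close> (\<open>det_substitute_rows_cols\<close>). The injective \<open>g\<close> are the permutations
  that map every block to itself, so there are \<open>n\<^sub>1! \<cdots> n\<^sub>p!\<close> of them
  (\<open>card_inj_PiE_block_preserving\<close>).
\<close>

section \<open>Sums over functions on a disjoint union\<close>

lemma sum_PiE_insert:
  assumes "i \<notin> J"
  shows "(\<Sum>f\<in>Pi\<^sub>E (insert i J) S. F f) = (\<Sum>x\<in>S i. \<Sum>f\<in>Pi\<^sub>E J S. F (f(i := x)))"
proof -
  have "(\<Sum>f\<in>Pi\<^sub>E (insert i J) S. F f) = (\<Sum>(x, f)\<in>S i \<times> Pi\<^sub>E J S. F (f(i := x)))"
    unfolding PiE_insert_eq
    by (subst sum.reindex[OF inj_combinator[OF assms]]) (simp add: case_prod_beta comp_def)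
  then show ?thesis
    by (simp add: sum.cartesian_product)
qed

lemma sum_PiE_Un:
  fixes F G :: "('a \<Rightarrow> 'b) \<Rightarrow> 'c :: comm_semiring_1"
  assumes disj: "X \<inter> Y = {}"
    and F: "\<And>f g. (\<And>i. i \<in> X \<Longrightarrow> f i = g i) \<Longrightarrow> F f = F g"
    and G: "\<And>f g. (\<And>i. i \<in> Y \<Longrightarrow> f i = g i) \<Longrightarrow> G f = G g"
  shows "(\<Sum>f\<in>Pi\<^sub>E X S. F f) * (\<Sum>g\<in>Pi\<^sub>E Y S. G g) = (\<Sum>h\<in>Pi\<^sub>E (X \<union> Y) S. F h * G h)"
proof -
  have "(\<Sum>f\<in>Pi\<^sub>E X S. F f) * (\<Sum>g\<in>Pi\<^sub>E Y S. G g)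
      = (\<Sum>(f, g)\<in>Pi\<^sub>E X S \<times> Pi\<^sub>E Y S. F f * G g)"
    by (simp add: sum_product sum.cartesian_product)
  also have "\<dots> = (\<Sum>h\<in>Pi\<^sub>E (X \<union> Y) S. F h * G h)"
  proof (rule sum.reindex_bij_witness[where
        i = "\<lambda>h. (restrict h X, restrict h Y)" and
        j = "\<lambda>(f, g) i. if i \<in> X then f i else g i"], goal_cases)
    case (1 a)
    obtain f g where a: "a = (f, g)" "f \<in> Pi\<^sub>E X S" "g \<in> Pi\<^sub>E Y S"
      using 1 by auto
    have "restrict (\<lambda>i. if i \<in> X then f i else g i) X = f"
      using a(2) by (auto simp: fun_eq_iff PiE_def extensional_def)
    moreover have "restrict (\<lambda>i. if i \<in> X then f i else g i) Y = g"
      using a(3) disj by (auto simp: fun_eq_iff PiE_def extensional_def)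
    ultimately show ?case by (simp add: a(1))
  next
    case (2 a)
    then show ?case by (auto simp: PiE_def extensional_def)
  next
    case (3 h)
    then show ?case by (auto simp: fun_eq_iff PiE_def extensional_def)
  next
    case (4 h)
    then show ?case by (auto simp: PiE_def)
  next
    case (5 a)
    obtain f g where a: "a = (f, g)" by (cases a)
    have "F (\<lambda>i. if i \<in> X then f i else g i) = F f"
      by (rule F) simp
    moreover have "G (\<lambda>i. if i \<in> X then f i else g i) = G g"
      by (rule G) (use disj in auto)
    ultimately show ?case by (simp add: a)
  qed
  finally show ?thesis .
qed

text \<open>Distributivity for blocks of variables: a function on a disjoint union is a family of functions
  on the parts, and \<open>F a\<close> only sees the part \<open>X a\<close>. It serves twice below, for the orbits of a
  permutation and for the blocks of a matrix.\<close>

lemma prod_sum_PiE_disjoint_UN: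
  fixes F :: "'k \<Rightarrow> ('a \<Rightarrow> 'b) \<Rightarrow> 'c :: comm_semiring_1"
  assumes "finite K" and "disjoint_family_on X K"
    and F: "\<And>a f g. a \<in> K \<Longrightarrow> (\<And>i. i \<in> X a \<Longrightarrow> f i = g i) \<Longrightarrow> F a f = F a g"
  shows "(\<Prod>a\<in>K. \<Sum>f\<in>Pi\<^sub>E (X a) S. F a f) = (\<Sum>f\<in>Pi\<^sub>E (\<Union>a\<in>K. X a) S. \<Prod>a\<in>K. F a f)"
  using assms
proof (induction K rule: finite_induct)
  case empty
  show ?case by simp
next
  case (insert k K)
  have disj: "X k \<inter> (\<Union>a\<in>K. X a) = {}"
    using insert.prems(1) insert.hyps(2) by (fastforce simp: disjoint_family_on_def)
  have IH: "(\<Prod>a\<in>K. \<Sum>f\<in>Pi\<^sub>E (X a) S. F a f) = (\<Sum>f\<in>Pi\<^sub>E (\<Union>a\<in>K. X a) S. \<Prod>a\<in>K. F a f)"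
  proof (rule insert.IH)
    show "disjoint_family_on X K"
      using insert.prems(1) by (rule disjoint_family_on_mono[rotated]) blast
    show "F a f = F a g" if "a \<in> K" "\<And>i. i \<in> X a \<Longrightarrow> f i = g i" for a f g
      by (rule insert.prems(2)) (use that in blast)+
  qed
  have "(\<Prod>a\<in>insert k K. \<Sum>f\<in>Pi\<^sub>E (X a) S. F a f)
      = (\<Sum>f\<in>Pi\<^sub>E (X k) S. F k f) * (\<Sum>f\<in>Pi\<^sub>E (\<Union>a\<in>K. X a) S. \<Prod>a\<in>K. F a f)"
    using insert.hyps IH by simp
  also have "\<dots> = (\<Sum>f\<in>Pi\<^sub>E (X k \<union> (\<Union>a\<in>K. X a)) S. F k f * (\<Prod>a\<in>K. F a f))"
  proof (rule sum_PiE_Un[OF disj])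
    show "F k f = F k g" if "\<And>i. i \<in> X k \<Longrightarrow> f i = g i" for f g
      by (rule insert.prems(2)[OF insertI1 that])
    show "(\<Prod>a\<in>K. F a f) = (\<Prod>a\<in>K. F a g)" if "\<And>i. i \<in> (\<Union>a\<in>K. X a) \<Longrightarrow> f i = g i" for f g
      by (rule prod.cong[OF refl], rule insert.prems(2)) (use that in auto)
  qed
  finally show ?case
    using insert.hyps by simp
qed

section \<open>The trace of a product along a cycle\<close>

text \<open>The vertices of a path are pairs of an index \<open>i\<close> and a row of the blocks \<open>B i _\<close>. Keeping the row
  in the vertex, instead of reading it off a function of \<open>i\<close>, allows a path to return to its
  starting index in a different row, as the off-diagonal entries of a product around a cycle
  require.\<close>

fun path_weight :: "('i \<Rightarrow> 'i \<Rightarrow> 'a :: comm_semiring_1 mat) \<Rightarrow> 'i \<times> nat \<Rightarrow> ('i \<times> nat) list \<Rightarrow> 'a" where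
  "path_weight B u [] = 1"
| "path_weight B u (v # vs) = B (fst u) (fst v) $$ (snd u, snd v) * path_weight B v vs"

lemma path_weight_map:
  "path_weight B (i, f i) (map (\<lambda>j. (j, f j)) (js @ [k])) =
    prod_list (map2 (\<lambda>a b. B a b $$ (f a, f b)) (i # js) (js @ [k]))"
  by (induction js arbitrary: i) auto

text \<open>An entry of a product of matrices is a sum over paths between the two outer indices. Because the
  inner indices \<open>js\<close> are distinct, the paths are parametrised by functions on the set of \<open>js\<close>, and
  the first inner index can be split off in the induction. The end \<open>k\<close> may coincide with \<open>i\<close>;
  this is the case needed for cycles.\<close>

lemma list_product_homogeneous:
  fixes B :: "nat \<Rightarrow> nat \<Rightarrow> complex mat"
  assumes B: "\<And>i j. B i j \<in> carrier_mat (s i) (s j)" and "distinct js"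
  shows "\<exists>P \<in> carrier_mat (s i) (s k).
    list_product (map2 (\<lambda>i j. homogeneous (B i j)) (i # js) (js @ [k])) = homogeneous P \<and>
    (\<forall>x<s i. \<forall>y<s k. P $$ (x, y) =
      (\<Sum>f\<in>Pi\<^sub>E (set js) (\<lambda>j. {..<s j}). path_weight B (i, x) (map (\<lambda>j. (j, f j)) js @ [(k, y)])))"
  using assms(2)
proof (induction js arbitrary: i)
  case Nil
  show ?case
    by (rule bexI[of _ "B i k"]) (auto simp: B)
next
  case (Cons j js)
  let ?W = "\<lambda>z y f. path_weight B (j, z) (map (\<lambda>j. (j, f j)) js @ [(k, y)])"
  have "distinct js" and j: "j \<notin> set js" using Cons.prems by auto
  from Cons.IH[OF this(1), of j] obtain P where P: "P \<in> carrier_mat (s j) (s k)"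
    and prod: "list_product (map2 (\<lambda>i j. homogeneous (B i j)) (j # js) (js @ [k])) = homogeneous P"
    and entry: "\<And>x y. x < s j \<Longrightarrow> y < s k \<Longrightarrow> P $$ (x, y) = (\<Sum>f\<in>Pi\<^sub>E (set js) (\<lambda>j. {..<s j}). ?W x y f)"
    by blast
  have BP: "B i j * P \<in> carrier_mat (s i) (s k)"
    using B P by (rule mult_carrier_mat)
  have "list_product (map2 (\<lambda>i j. homogeneous (B i j)) (i # j # js) ((j # js) @ [k]))
      = homogeneous (B i j) * list_product (map2 (\<lambda>i j. homogeneous (B i j)) (j # js) (js @ [k]))"
  proof -
    have "map2 (\<lambda>i j. homogeneous (B i j)) (j # js) (js @ [k]) \<noteq> []"
      by (cases js) auto
    from list_product_Cons[OF this] show ?thesis by simp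
  qed
  also have "\<dots> = homogeneous (B i j * P)"
    using B[of i j] P by (simp add: prod homogeneous_times)
  finally have 1: "list_product (map2 (\<lambda>i j. homogeneous (B i j)) (i # j # js) ((j # js) @ [k]))
      = homogeneous (B i j * P)" .
  have 2: "(B i j * P) $$ (x, y) = (\<Sum>f\<in>Pi\<^sub>E (set (j # js)) (\<lambda>j. {..<s j}).
      path_weight B (i, x) (map (\<lambda>j. (j, f j)) (j # js) @ [(k, y)]))" if "x < s i" "y < s k" for x y
  proof -
    have "(B i j * P) $$ (x, y) = (\<Sum>z<s j. B i j $$ (x, z) * P $$ (z, y))"
      using B[of i j] P that by (auto simp: scalar_prod_def atLeast0LessThan)
    also have "\<dots> = (\<Sum>z<s j. \<Sum>f\<in>Pi\<^sub>E (set js) (\<lambda>j. {..<s j}). B i j $$ (x, z) * ?W z y f)"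
      using that by (intro sum.cong) (auto simp: entry sum_distrib_left)
    also have "\<dots> = (\<Sum>z<s j. \<Sum>f\<in>Pi\<^sub>E (set js) (\<lambda>j. {..<s j}).
        path_weight B (i, x) (map (\<lambda>l. (l, (f(j := z)) l)) (j # js) @ [(k, y)]))"
    proof (intro sum.cong refl)
      fix z :: nat and f :: "nat \<Rightarrow> nat"
      have "map (\<lambda>l. (l, (f(j := z)) l)) js = map (\<lambda>l. (l, f l)) js"
        using j by auto
      then show "B i j $$ (x, z) * ?W z y f =
          path_weight B (i, x) (map (\<lambda>l. (l, (f(j := z)) l)) (j # js) @ [(k, y)])"
        by (simp del: map_eq_conv)
    qed
    also have "\<dots> = (\<Sum>f\<in>Pi\<^sub>E (set (j # js)) (\<lambda>j. {..<s j}).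
        path_weight B (i, x) (map (\<lambda>j. (j, f j)) (j # js) @ [(k, y)]))"
      using j
        sum_PiE_insert[of j "set js" "\<lambda>f. path_weight B (i, x) (map (\<lambda>j. (j, f j)) (j # js) @ [(k, y)])"
          "\<lambda>j. {..<s j}"]
      by simp
    finally show ?thesis .
  qed
  show ?case
    using BP 1 2 by blast
qed

text \<open>Taking the trace closes the paths: the common first and last row becomes the value of the function
  at the starting index, and the sum runs over functions on the whole cycle.\<close>

lemma tau_list_product_cycle:
  fixes B :: "nat \<Rightarrow> nat \<Rightarrow> complex mat"
  assumes B: "\<And>i j. B i j \<in> carrier_mat (s i) (s j)" and "distinct is" and "is \<noteq> []"
  shows "tau (list_product (map2 (\<lambda>i j. homogeneous (B i j)) is (rotate1 is))) =
    (\<Sum>f\<in>Pi\<^sub>E (set is) (\<lambda>i. {..<s i}). prod_list (map2 (\<lambda>i j. B i j $$ (f i, f j)) is (rotate1 is)))"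
proof -
  obtain i js where "is": "is = i # js" using assms(3) by (cases "is") auto
  have i: "i \<notin> set js" and "distinct js" using assms(2) by (auto simp: "is")
  let ?W = "\<lambda>f. path_weight B (i, f i) (map (\<lambda>j. (j, f j)) (js @ [i]))"
  from list_product_homogeneous[of B s js i i, OF B \<open>distinct js\<close>]
  obtain P where P: "P \<in> carrier_mat (s i) (s i)"
    and prod: "list_product (map2 (\<lambda>i j. homogeneous (B i j)) is (rotate1 is)) = homogeneous P"
    and entry: "\<And>x. x < s i \<Longrightarrow> P $$ (x, x) = (\<Sum>f\<in>Pi\<^sub>E (set js) (\<lambda>j. {..<s j}).
      path_weight B (i, x) (map (\<lambda>j. (j, f j)) js @ [(i, x)]))"
    unfolding "is" rotate1.simps by blast
  have "tau (homogeneous P) = (\<Sum>x<s i. P $$ (x, x))"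
    using P by (simp add: tau_homogeneous mat_trace_def)
  also have "\<dots> = (\<Sum>x<s i. \<Sum>f\<in>Pi\<^sub>E (set js) (\<lambda>j. {..<s j}). ?W (f(i := x)))"
  proof (intro sum.cong refl)
    fix x assume "x \<in> {..<s i}"
    moreover have "map (\<lambda>j. (j, (f(i := x)) j)) js = map (\<lambda>j. (j, f j)) js" for f
      using i by auto
    ultimately show "P $$ (x, x) = (\<Sum>f\<in>Pi\<^sub>E (set js) (\<lambda>j. {..<s j}). ?W (f(i := x)))"
      by (simp add: entry del: map_eq_conv)
  qed
  also have "\<dots> = (\<Sum>f\<in>Pi\<^sub>E (set is) (\<lambda>i. {..<s i}). ?W f)"
    using sum_PiE_insert[OF i, of ?W "\<lambda>i. {..<s i}"] by (simp add: "is")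
  finally show ?thesis
    unfolding prod path_weight_map by (simp add: "is")
qed

section \<open>The trace-determinant as a sum of determinants\<close>

lemma map_support_eq_rotate1:
  assumes "permutation \<sigma>"
  shows "map \<sigma> (support \<sigma> i) = rotate1 (support \<sigma> i)"
proof -
  have "length (support \<sigma> (\<sigma> i)) = length (support \<sigma> i)"
    unfolding support_apply[OF assms] by simp
  then have "least_power \<sigma> (\<sigma> i) = least_power \<sigma> i" by simp
  then show ?thesis
    unfolding support_apply[OF assms, symmetric] by (simp add: funpow_swap1)
qed

lemma cycle_trace_orbit:
  fixes B :: "nat \<Rightarrow> nat \<Rightarrow> complex mat"
  assumes B: "\<And>i j. B i j \<in> carrier_mat (s i) (s j)"
    and \<sigma>: "\<sigma> permutes {0..<n}" and i: "i < n"
  shows "cycle_trace (mat n n (\<lambda>(i, j). homogeneous (B i j))) (support \<sigma> i) =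
    (\<Sum>f\<in>Pi\<^sub>E (orbit \<sigma> i) (\<lambda>i. {..<s i}). \<Prod>j\<in>orbit \<sigma> i. B j (\<sigma> j) $$ (f j, f (\<sigma> j)))"
proof -
  have perm: "permutation \<sigma>" using \<sigma> permutation_permutes by blast
  let ?c = "support \<sigma> i"
  have set: "set ?c = orbit \<sigma> i"
    unfolding support_set[OF perm] orbit_altdef_permutation[OF perm] by auto
  have dist: "distinct ?c" using cycle_of_permutation[OF perm] .
  have ne: "?c \<noteq> []" using least_power_of_permutation(2)[OF perm, of i] by simp
  have lt: "set ?c \<subseteq> {0..<n}"
    unfolding set using permutes_orbit_subset[OF \<sigma>] i by simp
  have lt': "set (rotate1 ?c) \<subseteq> {0..<n}"
    using lt by (simp only: set_rotate1)
  have "map2 (\<lambda>i j. mat n n (\<lambda>(i, j). homogeneous (B i j)) $$ (i, j)) ?c (rotate1 ?c)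
      = map2 (\<lambda>i j. homogeneous (B i j)) ?c (rotate1 ?c)"
  proof (rule map_cong[OF refl], clarify)
    fix a b assume ab: "(a, b) \<in> set (zip ?c (rotate1 ?c))"
    have "a < n" "b < n"
      using set_zip_leftD[OF ab] set_zip_rightD[OF ab] lt lt' by (meson atLeastLessThan_iff subsetD)+
    then show "mat n n (\<lambda>(i, j). homogeneous (B i j)) $$ (a, b) = homogeneous (B a b)" by simp
  qed
  then have "cycle_trace (mat n n (\<lambda>(i, j). homogeneous (B i j))) ?c =
      (\<Sum>f\<in>Pi\<^sub>E (set ?c) (\<lambda>i. {..<s i}). prod_list (map2 (\<lambda>i j. B i j $$ (f i, f j)) ?c (rotate1 ?c)))"
    unfolding cycle_trace_def using tau_list_product_cycle[OF B dist ne] by (simp only:)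
  also have "\<dots> = (\<Sum>f\<in>Pi\<^sub>E (set ?c) (\<lambda>i. {..<s i}). \<Prod>j\<in>set ?c. B j (\<sigma> j) $$ (f j, f (\<sigma> j)))"
  proof (intro sum.cong refl)
    fix f
    have "map2 (\<lambda>i j. B i j $$ (f i, f j)) xs (map \<sigma> xs) = map (\<lambda>j. B j (\<sigma> j) $$ (f j, f (\<sigma> j))) xs" for xs
      by (induction xs) auto
    then show "prod_list (map2 (\<lambda>i j. B i j $$ (f i, f j)) ?c (rotate1 ?c)) =
        (\<Prod>j\<in>set ?c. B j (\<sigma> j) $$ (f j, f (\<sigma> j)))"
      unfolding map_support_eq_rotate1[OF perm, symmetric] prod.distinct_set_conv_list[OF dist]
      by (simp only:)
  qed
  finally show ?thesis unfolding set .
qed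

text \<open>Since the orbits of \<open>\<sigma>\<close> are disjoint, the product over the cycles expands into a sum over
  functions on the whole index set. The range of this sum is the same for all \<open>\<sigma>\<close>, so it can be
  exchanged with the sum over \<open>\<sigma>\<close>, which leaves a Leibniz expansion for each function.\<close>

lemma det_Tr_homogeneous:
  fixes B :: "nat \<Rightarrow> nat \<Rightarrow> complex mat"
  assumes B: "\<And>i j. B i j \<in> carrier_mat (s i) (s j)"
  shows "det_Tr (mat n n (\<lambda>(i, j). homogeneous (B i j))) =
    (\<Sum>f\<in>Pi\<^sub>E {0..<n} (\<lambda>i. {..<s i}). det (mat n n (\<lambda>(i, j). B i j $$ (f i, f j))))"
proof -
  let ?M = "mat n n (\<lambda>(i, j). homogeneous (B i j))"
  let ?w = "\<lambda>\<sigma> f j. B j (\<sigma> j) $$ (f j, f (\<sigma> j))"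
  have cycles: "(\<Prod>C\<in>orbit \<sigma> ` {0..<n}. cycle_trace ?M (support \<sigma> (Min C))) =
      (\<Sum>f\<in>Pi\<^sub>E {0..<n} (\<lambda>i. {..<s i}). \<Prod>j\<in>{0..<n}. ?w \<sigma> f j)"
    if \<sigma>: "\<sigma> permutes {0..<n}" for \<sigma>
  proof -
    let ?O = "orbit \<sigma> ` {0..<n}"
    have perm: "permutation \<sigma>" using \<sigma> permutation_permutes by blast
    have orbit_eq: "orbit \<sigma> j = orbit \<sigma> i" if "j \<in> orbit \<sigma> i" for i j
      using orbit_cyclic_eq3[OF cyclic_on_orbit'[OF perm] that] .
    have sub: "C \<subseteq> {0..<n}" if "C \<in> ?O" for C
      using that permutes_orbit_subset[OF \<sigma>] by blast
    have Un: "\<Union>?O = {0..<n}"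
      using sub permutation_self_in_orbit[OF perm] by blast
    have fin: "finite C" if "C \<in> ?O" for C
      using sub[OF that] finite_subset by blast
    have disj: "C \<inter> D = {}" if "C \<in> ?O" "D \<in> ?O" "C \<noteq> D" for C D
      using that orbit_eq by blast
    have "(\<Prod>C\<in>?O. cycle_trace ?M (support \<sigma> (Min C))) =
        (\<Prod>C\<in>?O. \<Sum>f\<in>Pi\<^sub>E C (\<lambda>i. {..<s i}). \<Prod>j\<in>C. ?w \<sigma> f j)"
    proof (rule prod.cong[OF refl])
      fix C assume C: "C \<in> ?O"
      then have "C \<noteq> {}" using orbit_nonempty by force
      then have Min: "Min C \<in> C" using fin[OF C] by (rule Min_in[rotated])
      then have "orbit \<sigma> (Min C) = C" using C orbit_eq by blast
      moreover have "Min C < n" using Min sub[OF C] by force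
      ultimately show "cycle_trace ?M (support \<sigma> (Min C)) =
          (\<Sum>f\<in>Pi\<^sub>E C (\<lambda>i. {..<s i}). \<Prod>j\<in>C. ?w \<sigma> f j)"
        using cycle_trace_orbit[OF B \<sigma>, of "Min C"] by simp
    qed
    also have "\<dots> = (\<Sum>f\<in>Pi\<^sub>E (\<Union>C\<in>?O. C) (\<lambda>i. {..<s i}). \<Prod>C\<in>?O. \<Prod>j\<in>C. ?w \<sigma> f j)"
    proof (rule prod_sum_PiE_disjoint_UN)
      show "disjoint_family_on (\<lambda>C. C) ?O"
        unfolding disjoint_family_on_def using disj by blast
      fix C and f g :: "nat \<Rightarrow> nat"
      assume C: "C \<in> ?O" and fg: "\<And>i. i \<in> C \<Longrightarrow> f i = g i"
      \<comment> \<open>The factor of a cycle depends on the function at \<open>\<sigma> j\<close> as well as at \<open>j\<close>, so closure of the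
        orbit under \<open>\<sigma>\<close> is what makes the factors independent.\<close>
      have "\<sigma> j \<in> C" if "j \<in> C" for j
        using C that by (auto intro: orbit.step)
      then show "(\<Prod>j\<in>C. ?w \<sigma> f j) = (\<Prod>j\<in>C. ?w \<sigma> g j)"
        by (intro prod.cong refl) (simp add: fg)
    qed simp
    also have "\<dots> = (\<Sum>f\<in>Pi\<^sub>E {0..<n} (\<lambda>i. {..<s i}). \<Prod>j\<in>{0..<n}. ?w \<sigma> f j)"
      using prod.Union_disjoint[of ?O "?w \<sigma> f" for f] fin disj by (simp add: Un)
    finally show ?thesis .
  qed
  have "det_Tr ?M = (\<Sum>\<sigma> | \<sigma> permutes {0..<n}. \<Sum>f\<in>Pi\<^sub>E {0..<n} (\<lambda>i. {..<s i}).
      of_int (sign \<sigma>) * (\<Prod>j\<in>{0..<n}. ?w \<sigma> f j))"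
    unfolding det_Tr_def by (auto intro!: sum.cong simp: cycles sum_distrib_left)
  also have "\<dots> = (\<Sum>f\<in>Pi\<^sub>E {0..<n} (\<lambda>i. {..<s i}). \<Sum>\<sigma> | \<sigma> permutes {0..<n}.
      of_int (sign \<sigma>) * (\<Prod>j\<in>{0..<n}. ?w \<sigma> f j))"
    by (rule sum.swap)
  also have "\<dots> = (\<Sum>f\<in>Pi\<^sub>E {0..<n} (\<lambda>i. {..<s i}). det (mat n n (\<lambda>(i, j). B i j $$ (f i, f j))))"
    by (intro sum.cong refl) (auto simp: det_def intro!: sum.cong prod.cong dest: permutes_in_image)
  finally show ?thesis .
qed

section \<open>Simultaneous substitution of rows and columns\<close>

text \<open>A repeated index gives two equal rows; a permutation contributes its sign once for the rows and
  once for the columns.\<close>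

lemma det_substitute_rows_cols:
  fixes A :: "'a :: comm_ring_1 mat"
  assumes A: "A \<in> carrier_mat n n" and g: "g ` {0..<n} \<subseteq> {0..<n}"
  shows "det (mat n n (\<lambda>(i, j). A $$ (g i, g j))) = (if inj_on g {0..<n} then det A else 0)"
proof (cases "inj_on g {0..<n}")
  case True
  define \<pi> where "\<pi> i = (if i < n then g i else i)" for i
  have "bij_betw g {0..<n} {0..<n}"
    using True g by (simp add: bij_betw_def endo_inj_surj)
  then have "bij_betw \<pi> {0..<n} {0..<n}"
    by (rule bij_betw_cong[THEN iffD1, rotated]) (simp add: \<pi>_def)
  then have \<pi>: "\<pi> permutes {0..<n}"
    by (rule bij_imp_permutes) (simp add: \<pi>_def)
  have lt: "\<pi> i < n" if "i < n" for i
    using permutes_in_image[OF \<pi>, of i] that by simp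
  define R where "R = mat n n (\<lambda>(i, j). A $$ (\<pi> i, j))"
  have R: "R \<in> carrier_mat n n" by (simp add: R_def)
  have "mat n n (\<lambda>(i, j). A $$ (g i, g j)) = (mat n n (\<lambda>(i, j). R\<^sup>T $$ (\<pi> i, j)))\<^sup>T"
    by (rule eq_matI) (use lt in \<open>auto simp: R_def \<pi>_def\<close>)
  then have "det (mat n n (\<lambda>(i, j). A $$ (g i, g j))) = det (mat n n (\<lambda>(i, j). R\<^sup>T $$ (\<pi> i, j)))"
    using det_transpose[of "mat n n (\<lambda>(i, j). R\<^sup>T $$ (\<pi> i, j))" n] by simp
  also have "\<dots> = of_int (sign \<pi>) * (of_int (sign \<pi>) * det A)"
    using det_permute_rows[OF transpose_carrier_mat[THEN iffD2, OF R] \<pi>] det_transpose[OF R]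
      det_permute_rows[OF A \<pi>]
    by (simp add: R_def)
  also have "\<dots> = det A"
    by (simp add: sign_def)
  finally show ?thesis using True by simp
next
  case False
  then obtain i j where ij: "i < n" "j < n" "i \<noteq> j" "g i = g j"
    by (auto simp: inj_on_def)
  have "det (mat n n (\<lambda>(i, j). A $$ (g i, g j))) = 0"
    by (rule det_identical_rows[of _ n i j]) (use ij in auto)
  then show ?thesis using False by simp
qed

section \<open>Counting the permutations that preserve every block\<close>

lemma card_inj_PiE_self:
  assumes "finite X"
  shows "card {g \<in> X \<rightarrow>\<^sub>E X. inj_on g X} = fact (card X)"
proof -
  have "bij_betw (\<lambda>\<pi>. restrict \<pi> X) {\<pi>. \<pi> permutes X} {g \<in> X \<rightarrow>\<^sub>E X. inj_on g X}"
  proof (rule bij_betw_byWitness[where f' = "\<lambda>g i. if i \<in> X then g i else i"])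
    show "\<forall>\<pi>\<in>{\<pi>. \<pi> permutes X}. (\<lambda>i. if i \<in> X then restrict \<pi> X i else i) = \<pi>"
      by (auto simp: fun_eq_iff permutes_not_in)
    show "\<forall>g\<in>{g \<in> X \<rightarrow>\<^sub>E X. inj_on g X}. restrict (\<lambda>i. if i \<in> X then g i else i) X = g"
      by (auto simp: fun_eq_iff PiE_def extensional_def)
    show "(\<lambda>\<pi>. restrict \<pi> X) ` {\<pi>. \<pi> permutes X} \<subseteq> {g \<in> X \<rightarrow>\<^sub>E X. inj_on g X}"
      by (auto simp: permutes_in_image inj_on_restrict_eq intro: permutes_inj_on)
    show "(\<lambda>g i. if i \<in> X then g i else i) ` {g \<in> X \<rightarrow>\<^sub>E X. inj_on g X} \<subseteq> {\<pi>. \<pi> permutes X}"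
    proof clarify
      fix g assume g: "g \<in> X \<rightarrow>\<^sub>E X" "inj_on g X"
      then have "bij_betw g X X"
        using assms by (auto simp: bij_betw_def intro: endo_inj_surj[THEN equalityD2, THEN subsetD])
      then have "bij_betw (\<lambda>i. if i \<in> X then g i else i) X X"
        by (rule bij_betw_cong[THEN iffD1, rotated]) simp
      then show "(\<lambda>i. if i \<in> X then g i else i) permutes X"
        by (rule bij_imp_permutes) simp
    qed
  qed
  then have "card {g \<in> X \<rightarrow>\<^sub>E X. inj_on g X} = card {\<pi>. \<pi> permutes X}"
    by (rule bij_betw_same_card[symmetric])
  then show ?thesis
    using card_permutations[OF refl assms] by simp
qed

text \<open>As every value stays in the part of its argument, values from different parts never collide, so
  injectivity can be tested on each part separately. Its indicator is then a product over the parts,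
  and distributivity turns the count into a product of counts.\<close>

lemma card_inj_PiE_block_preserving:
  assumes K: "finite K" and disj: "disjoint_family_on X K" and fin: "\<And>a. a \<in> K \<Longrightarrow> finite (X a)"
    and S: "\<And>a i. a \<in> K \<Longrightarrow> i \<in> X a \<Longrightarrow> S i = X a"
  shows "card {g \<in> Pi\<^sub>E (\<Union>a\<in>K. X a) S. inj_on g (\<Union>a\<in>K. X a)} = (\<Prod>a\<in>K. fact (card (X a)))"
proof -
  let ?U = "\<Union>a\<in>K. X a"
  have PiE: "Pi\<^sub>E (X a) S = X a \<rightarrow>\<^sub>E X a" if "a \<in> K" for a
    using that S by (intro PiE_cong) auto
  have inj: "inj_on g ?U \<longleftrightarrow> (\<forall>a\<in>K. inj_on g (X a))" if "g \<in> Pi\<^sub>E ?U S" for g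
  proof
    assume "inj_on g ?U"
    then show "\<forall>a\<in>K. inj_on g (X a)"
      by (meson UN_upper inj_on_subset)
  next
    assume *: "\<forall>a\<in>K. inj_on g (X a)"
    show "inj_on g ?U"
    proof (rule inj_onI, clarify)
      fix i j a b assume ab: "a \<in> K" "b \<in> K" "i \<in> X a" "j \<in> X b" and eq: "g i = g j"
      have "g i \<in> X a" "g j \<in> X b"
        using that ab S by (metis PiE_mem UN_I)+
      then have "a = b"
        using eq ab disj by (metis IntI disjoint_family_onD emptyE)
      then show "i = j"
        using * ab eq by (metis inj_onD)
    qed
  qed
  have fin_PiE: "finite (Pi\<^sub>E ?U S)"
    using K fin S by (intro finite_PiE) auto
  have "card {g \<in> Pi\<^sub>E ?U S. inj_on g ?U} = (\<Sum>g\<in>Pi\<^sub>E ?U S. if inj_on g ?U then 1 else 0)"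
    using fin_PiE by (simp add: sum.inter_filter[symmetric])
  also have "\<dots> = (\<Sum>g\<in>Pi\<^sub>E ?U S. \<Prod>a\<in>K. if inj_on g (X a) then 1 else 0)"
    using K by (intro sum.cong refl) (auto simp: inj)
  also have "\<dots> = (\<Prod>a\<in>K. \<Sum>g\<in>Pi\<^sub>E (X a) S. if inj_on g (X a) then 1 else 0)"
    by (rule prod_sum_PiE_disjoint_UN[OF K disj, symmetric]) (simp cong: inj_on_cong)
  also have "\<dots> = (\<Prod>a\<in>K. fact (card (X a)))"
  proof (rule prod.cong[OF refl])
    fix a assume a: "a \<in> K"
    then have "finite (X a \<rightarrow>\<^sub>E X a)" using fin by (intro finite_PiE) auto
    then show "(\<Sum>g\<in>Pi\<^sub>E (X a) S. if inj_on g (X a) then 1 else 0) = fact (card (X a))"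
      using card_inj_PiE_self[OF fin[OF a]] by (simp add: PiE[OF a] sum.inter_filter[symmetric])
  qed
  finally show ?thesis .
qed

section \<open>The block intervals\<close>

lemma block_index_in:
  assumes "i < (\<Sum>a<p. d a)"
  shows "block_index p d i < p" "i \<in> block_interval d (block_index p d i)"
  using theI'[OF block_index_unique[OF assms]] by (auto simp: block_index_def)

lemma block_interval_subset:
  assumes "a < p"
  shows "block_interval d a \<subseteq> {0..<\<Sum>a<p. d a}"
proof -
  have "offset d a + d a = (\<Sum>b<Suc a. d b)" by (simp add: offset_def)
  also have "\<dots> \<le> (\<Sum>b<p. d b)" using assms by (intro sum_mono2) auto
  finally show ?thesis by (auto simp: block_interval_def)
qed

lemma block_index_eq:
  assumes "a < p" "i \<in> block_interval d a"
  shows "block_index p d i = a"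
proof -
  have "i < (\<Sum>a<p. d a)" using block_interval_subset[OF assms(1)] assms(2) by force
  then show ?thesis
    using block_index_unique[of i d p] block_index_in[of i d p] assms by blast
qed

lemma UN_block_interval: "(\<Union>a\<in>{..<p}. block_interval d a) = {0..<\<Sum>a<p. d a}"
proof
  show "(\<Union>a\<in>{..<p}. block_interval d a) \<subseteq> {0..<\<Sum>a<p. d a}"
    using block_interval_subset by (meson UN_least lessThan_iff)
  show "{0..<\<Sum>a<p. d a} \<subseteq> (\<Union>a\<in>{..<p}. block_interval d a)"
    using block_index_in[of _ d p] by fastforce
qed

lemma disjoint_block_interval: "disjoint_family_on (block_interval d) {..<p}"
proof (unfold disjoint_family_on_def, intro ballI impI equals0I)
  fix a b i assume "a \<in> {..<p}" "b \<in> {..<p}" "a \<noteq> b"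
    and "i \<in> block_interval d a \<inter> block_interval d b"
  then show False
    using block_index_eq[of a p i d] block_index_eq[of b p i d] by simp
qed

text \<open>Rows inside a block are counted from \<open>0\<close>; adding the offset of the block turns them into rows of
  \<open>A\<close>.\<close>

lemma det_Tr_diamond:
  fixes A :: "complex mat"
  assumes n: "n = (\<Sum>a<p. d a)"
  shows "det_Tr (diamond p d A) =
    (\<Sum>g\<in>Pi\<^sub>E {0..<n} (\<lambda>i. block_interval d (block_index p d i)). det (mat n n (\<lambda>(i, j). A $$ (g i, g j))))"
proof -
  let ?b = "block_index p d"
  let ?o = "\<lambda>i. offset d (?b i)"
  have "det_Tr (diamond p d A) = (\<Sum>f\<in>Pi\<^sub>E {0..<n} (\<lambda>i. {..<d (?b i)}).
      det (mat n n (\<lambda>(i, j). block d A (?b i) (?b j) $$ (f i, f j))))"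
    unfolding diamond_def n[symmetric] by (rule det_Tr_homogeneous) (simp add: block_def)
  also have "\<dots> = (\<Sum>g\<in>Pi\<^sub>E {0..<n} (\<lambda>i. block_interval d (?b i)). det (mat n n (\<lambda>(i, j). A $$ (g i, g j))))"
  proof (rule sum.reindex_bij_witness[where
        i = "\<lambda>g. \<lambda>i\<in>{0..<n}. g i - ?o i" and j = "\<lambda>f. \<lambda>i\<in>{0..<n}. ?o i + f i"], goal_cases)
    case (1 f)
    then show ?case by (auto simp: fun_eq_iff PiE_def extensional_def)
  next
    case (2 f)
    then show ?case by (auto simp: block_interval_def PiE_def Pi_def)
  next
    case (3 g)
    then have "?o i \<le> g i" if "i < n" for i
      using that by (auto simp: PiE_def Pi_def block_interval_def)
    with 3 show ?case by (auto simp: fun_eq_iff PiE_def extensional_def)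
  next
    case (4 g)
    then have "?o i \<le> g i \<and> g i < ?o i + d (?b i)" if "i < n" for i
      using that by (auto simp: PiE_def Pi_def block_interval_def)
    then show ?case by (auto simp: less_diff_conv2 add.commute)
  next
    case (5 f)
    then have "f i < d (?b i)" if "i < n" for i
      using that by (auto simp: PiE_def Pi_def)
    then have "mat n n (\<lambda>(i, j). block d A (?b i) (?b j) $$ (f i, f j)) =
        mat n n (\<lambda>(i, j). A $$ ((\<lambda>i\<in>{0..<n}. ?o i + f i) i, (\<lambda>i\<in>{0..<n}. ?o i + f i) j))"
      by (intro eq_matI) (auto simp: block_def)
    then show ?case by simp
  qed
  finally show ?thesis .
qed

section \<open>The determinant of a block matrix\<close>

theorem corollary1p2:
  fixes p n :: nat and d :: "nat \<Rightarrow> nat" and A :: "complex mat"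
  assumes "p \<ge> 1"
    and "\<And>a. a < p \<Longrightarrow> d a \<ge> 1"
    and "n = (\<Sum>a<p. d a)"
    and "A \<in> carrier_mat n n"
  shows "(\<Prod>a<p. fact (d a)) * det A = det_Tr (diamond p d A)"
proof -
  let ?S = "\<lambda>i. block_interval d (block_index p d i)"
  let ?G = "{g \<in> Pi\<^sub>E {0..<n} ?S. inj_on g {0..<n}}"
  have S: "?S i \<subseteq> {0..<n}" if "i < n" for i
    using block_index_in(1) block_interval_subset that assms(3) by metis
  have fin: "finite (Pi\<^sub>E {0..<n} ?S)"
    by (intro finite_PiE) (auto simp: block_interval_def)
  have "card ?G = (\<Prod>a<p. fact (card (block_interval d a)))"
    using card_inj_PiE_block_preserving[OF _ disjoint_block_interval, of p d ?S]
    unfolding UN_block_interval assms(3)[symmetric]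
    by (simp add: block_interval_def[of d] block_index_eq[unfolded block_interval_def])
  then have card: "card ?G = (\<Prod>a<p. fact (d a))"
    by (simp add: block_interval_def)
  have "det_Tr (diamond p d A) =
      (\<Sum>g\<in>Pi\<^sub>E {0..<n} ?S. det (mat n n (\<lambda>(i, j). A $$ (g i, g j))))"
    using assms(3) by (rule det_Tr_diamond)
  also have "\<dots> = (\<Sum>g\<in>Pi\<^sub>E {0..<n} ?S. if inj_on g {0..<n} then det A else 0)"
  proof (intro sum.cong refl det_substitute_rows_cols[OF assms(4)])
    fix g assume "g \<in> Pi\<^sub>E {0..<n} ?S"
    then show "g ` {0..<n} \<subseteq> {0..<n}" using S by (fastforce simp: PiE_def Pi_def)
  qed
  also have "\<dots> = of_nat (card ?G) * det A"
    using fin by (simp add: sum.inter_filter[symmetric])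
  finally show ?thesis
    by (simp add: card)
qed

end
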